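(* There exists a constant $\varepsilon>0$ such that for all $d,r\in\mathbb{N}$, every nonadaptive, 1-sided error $\varepsilon$-tester for monotonicity of functions $f\colon\{0,1\}^d\to[r]$ requires $\Omega(\min(r\sqrt d,d))$ queries.
   Context: $[r]=\{1,\dots,r\}$. The partial order on $\{0,1\}^d$ is $x\preceq y$ iff $x_i\le y_i$ for all $i$; $f$ is monotone if $f(x)\le f(y)$ whenever $x\preceq y$. $f$ is $\varepsilon$-far from monotone if $\Pr_{\boldsymbol{x}}[f(\boldsymbol{x})\ne g(\boldsymbol{x})]\ge\varepsilon$ for every monotone $g$ ($\boldsymbol{x}$ uniform). An $\varepsilon$-tester for monotonicity is a randomized algorithm with query access to $f$ that accepts with probability at least $2/3$ if $f$ is monotone and rejects with probability at least $2/3$ if $f$ is $\varepsilon$-far from monotone; nonadaptive means queries do not depend on answers to previous queries; 1-sided error means monotone functions are always accepted.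
   Formalization: The range size r is assumed to be at least 2: for r = 1 every function is constant, so the tester that always accepts with 0 queries is valid and the claimed bound fails for d ≥ 1; for r = 0 the bound is 0 and trivial. *)

theory Defs
  imports "HOL-Probability.Probability"
begin

type_synonym point = "nat \<Rightarrow> nat"

definition cube :: "nat \<Rightarrow> point set" where
  "cube d = ({1..d} \<rightarrow>\<^sub>E {0, 1})"

definition cube_le :: "nat \<Rightarrow> point \<Rightarrow> point \<Rightarrow> bool" where
  "cube_le d x y \<longleftrightarrow> (\<forall>i\<in>{1..d}. x i \<le> y i)"

text \<open>Values of a function outside the cube are irrelevant: every notion below only looks at
  its restriction to the cube.\<close>

definition cube_funs :: "nat \<Rightarrow> nat \<Rightarrow> (point \<Rightarrow> nat) set" where
  "cube_funs d r = (cube d \<rightarrow> {1..r})"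

definition cube_monotone :: "nat \<Rightarrow> (point \<Rightarrow> nat) \<Rightarrow> bool" where
  "cube_monotone d f \<longleftrightarrow> monotone_on (cube d) (cube_le d) (\<le>) f"

definition far_from_monotone :: "real \<Rightarrow> nat \<Rightarrow> nat \<Rightarrow> (point \<Rightarrow> nat) \<Rightarrow> bool" where
  "far_from_monotone \<epsilon> d r f \<longleftrightarrow>
     (\<forall>g\<in>cube_funs d r. cube_monotone d g \<longrightarrow>
        measure_pmf.prob (pmf_of_set (cube d)) {x. f x \<noteq> g x} \<ge> \<epsilon>)"

text \<open>A deterministic nonadaptive algorithm is a list of query points, fixed in advance, together
  with a decision function mapping the list of answers to accept (\<^term>\<open>True\<close>) or
  reject (\<^term>\<open>False\<close>).
  A randomized nonadaptive algorithm is a probability distribution over deterministic ones. Any coin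
  tosses of the decision phase are drawn in advance and are part of the sampled decision function.
  Discrete distributions lose no generality: with a bounded number of queries to a function from a
  finite domain to a finite range there are only finitely many essentially different
  deterministic algorithms.\<close>

type_synonym nonadaptive_alg = "(point list \<times> (nat list \<Rightarrow> bool)) pmf"

definition queries_in_cube :: "nat \<Rightarrow> nonadaptive_alg \<Rightarrow> bool" where
  "queries_in_cube d A \<longleftrightarrow> (\<forall>(qs, dec)\<in>set_pmf A. set qs \<subseteq> cube d)"

text \<open>Query complexity is worst case over the coin tosses.\<close>

definition makes_at_most_queries :: "nonadaptive_alg \<Rightarrow> nat \<Rightarrow> bool" where
  "makes_at_most_queries A q \<longleftrightarrow> (\<forall>(qs, dec)\<in>set_pmf A. length qs \<le> q)"

definition accept_prob :: "nonadaptive_alg \<Rightarrow> (point \<Rightarrow> nat) \<Rightarrow> real" where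
  "accept_prob A f = measure_pmf.prob A {(qs, dec). dec (map f qs)}"

definition reject_prob :: "nonadaptive_alg \<Rightarrow> (point \<Rightarrow> nat) \<Rightarrow> real" where
  "reject_prob A f = measure_pmf.prob A {(qs, dec). \<not> dec (map f qs)}"

definition nonadaptive_monotonicity_tester :: "real \<Rightarrow> nat \<Rightarrow> nat \<Rightarrow> nonadaptive_alg \<Rightarrow> bool" where
  "nonadaptive_monotonicity_tester \<epsilon> d r A \<longleftrightarrow>
     queries_in_cube d A \<and>
     (\<forall>f\<in>cube_funs d r.
        (cube_monotone d f \<longrightarrow> accept_prob A f \<ge> 2/3) \<and>
        (far_from_monotone \<epsilon> d r f \<longrightarrow> reject_prob A f \<ge> 2/3))"

definition one_sided_error :: "nat \<Rightarrow> nat \<Rightarrow> nonadaptive_alg \<Rightarrow> bool" where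
  "one_sided_error d r A \<longleftrightarrow>
     (\<forall>f\<in>cube_funs d r. cube_monotone d f \<longrightarrow> accept_prob A f = 1)"

end

theory Submission
  imports Defs
begin

text \<open>For each coordinate \<open>i\<close> consider the function which, on the middle layers of the cube, is
  an antidictator in direction \<open>i\<close> added to a step function of the weight of the remaining
  coordinates, with about \<open>r\<close> steps of \<open>w = O(\<surd>d / r + 1)\<close> levels each. By Chebyshev's inequality
  these layers carry a constant fraction of the cube, and there every edge in direction \<open>i\<close> is
  violated, so the function is far from monotone. The steps make every violated pair have distance
  at most \<open>w\<close>. A one-sided nonadaptive tester can only reject when its queries contain a violated
  pair. A spanning forest of the comparability graph on \<open>q\<close> queries, restricted to pairs at
  distance at most \<open>w\<close>, shows that at most \<open>q w\<close> directions \<open>i\<close> are separated by such pairs; but the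
  tester must detect every one of the \<open>d\<close> directions with probability \<open>2/3\<close>, so
  \<open>q w \<ge> 2 d / 3\<close>.\<close>

subsection \<open>Directions separated by close pairs\<close>

text \<open>The map \<open>c\<close> sends a vertex to a representative of its component, and \<open>U\<close> collects the
  coordinates along the edges of a spanning forest.\<close>
lemma spanning_forest_differences:
  fixes Q :: "('i \<Rightarrow> 'v) set" and I :: "'i set"
  assumes "finite Q" "finite I" "finite F" "F \<subseteq> Q \<times> Q"
    and "\<forall>(x, y)\<in>F. card {i\<in>I. x i \<noteq> y i} \<le> w"
  shows "\<exists>c U. (\<forall>(x, y)\<in>F. c x = c y) \<and> (\<forall>x\<in>Q. c x \<in> Q \<and> {i\<in>I. x i \<noteq> c x i} \<subseteq> U) \<and>
           U \<subseteq> I \<and> card U + w * card (c ` Q) \<le> w * card Q"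
  using assms(3-5)
proof (induction F rule: finite_induct)
  case empty
  show ?case by (intro exI[of _ id] exI[of _ "{}"]) auto
next
  case (insert e F)
  obtain x y where e: "e = (x, y)" by (cases e)
  have xy: "x \<in> Q" "y \<in> Q" and le: "card {i\<in>I. x i \<noteq> y i} \<le> w"
    using insert.prems e by auto
  from insert obtain c U where c: "\<forall>(x, y)\<in>F. c x = c y"
    and U: "\<forall>x\<in>Q. c x \<in> Q \<and> {i\<in>I. x i \<noteq> c x i} \<subseteq> U"
    and UI: "U \<subseteq> I" and card: "card U + w * card (c ` Q) \<le> w * card Q"
    by auto
  show ?case
  proof (cases "c x = c y")
    case True
    with c U UI card e show ?thesis by (intro exI[of _ c] exI[of _ U]) auto
  next
    case False
    \<comment> \<open>The component of \<open>y\<close> is merged into that of \<open>x\<close>. One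
      representative disappears, and the \<open>w\<close> this frees pays for the at most
      \<open>w\<close> coordinates added to \<open>U\<close>.\<close>
    define c' where "c' z = (if c z = c y then c x else c z)" for z
    define U' where "U' = U \<union> {i\<in>I. x i \<noteq> y i}"
    have "c' ` Q \<subseteq> c ` Q - {c y}"
      using xy False by (auto simp: c'_def)
    then have "card (c' ` Q) \<le> card (c ` Q) - 1"
      using \<open>finite Q\<close> xy card_mono[of "c ` Q - {c y}" "c' ` Q"] by simp
    moreover have "card (c ` Q) \<ge> 1"
      using \<open>finite Q\<close> xy by (simp add: Suc_le_eq card_gt_0_iff) blast
    ultimately have "w * card (c' ` Q) + w \<le> w * card (c ` Q)"
      by (metis add_mult_distrib2 le_diff_conv2 mult.right_neutral mult_le_mono2)
    moreover have "card U' \<le> card U + w"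
      unfolding U'_def using card_Un_le[of U "{i\<in>I. x i \<noteq> y i}"] le by linarith
    ultimately have "card U' + w * card (c' ` Q) \<le> w * card Q"
      using card by linarith
    moreover have "c' z \<in> Q \<and> {i\<in>I. z i \<noteq> c' z i} \<subseteq> U'" if "z \<in> Q" for z
    proof -
      have sub: "i \<in> U" if "i \<in> I" "z i \<noteq> c z i \<or> x i \<noteq> c x i \<or> y i \<noteq> c y i" for i
        using U xy \<open>z \<in> Q\<close> that by blast
      have "c' z \<in> Q" using U xy that by (auto simp: c'_def)
      moreover have "i \<in> U'" if i: "i \<in> I" "z i \<noteq> c' z i" for i
      proof (cases "c z = c y")
        case True
        \<comment> \<open>Here \<open>z\<close> reaches \<open>c' z = c x\<close> through
          \<open>c z = c y\<close>, \<open>y\<close> and \<open>x\<close>, so a coordinate that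
          changes overall changes on one of these four hops.\<close>
        then have "z i \<noteq> c z i \<or> x i \<noteq> c x i \<or> y i \<noteq> c y i \<or> x i \<noteq> y i"
          using i(2) unfolding c'_def by metis
        then show ?thesis using i(1) sub[of i] unfolding U'_def by blast
      next
        case False
        then show ?thesis using i sub[of i] by (simp add: U'_def c'_def)
      qed
      ultimately show ?thesis by auto
    qed
    moreover have "\<forall>(x, y)\<in>insert e F. c' x = c' y"
      using c e by (auto simp: c'_def)
    moreover have "U' \<subseteq> I" using UI by (auto simp: U'_def)
    ultimately show ?thesis by (intro exI[of _ c'] exI[of _ U']) auto
  qed
qed

text \<open>Close points share a representative, so a coordinate separating them separates one of
  them from it and lies in \<open>U\<close>. Counting along a forest instead of over all pairs keeps
  the bound linear in \<open>card Q\<close>.\<close>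

lemma card_directions_of_close_pairs:
  fixes Q :: "('i \<Rightarrow> 'v) set" and I :: "'i set"
  assumes "finite Q" "finite I"
  shows "card {i\<in>I. \<exists>x\<in>Q. \<exists>y\<in>Q. x i \<noteq> y i \<and> card {j\<in>I. x j \<noteq> y j} \<le> w} \<le> w * card Q"
proof -
  define F where "F = {(x, y)\<in>Q \<times> Q. card {j\<in>I. x j \<noteq> y j} \<le> w}"
  have F: "F \<subseteq> Q \<times> Q" "\<forall>(x, y)\<in>F. card {j\<in>I. x j \<noteq> y j} \<le> w" by (auto simp: F_def)
  then have "finite F" using \<open>finite Q\<close> by (meson finite_SigmaI finite_subset)
  then obtain c U where c: "\<forall>(x, y)\<in>F. c x = c y"
    and U: "\<forall>x\<in>Q. c x \<in> Q \<and> {i\<in>I. x i \<noteq> c x i} \<subseteq> U"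
    and UI: "U \<subseteq> I" and card: "card U + w * card (c ` Q) \<le> w * card Q"
    using spanning_forest_differences[OF assms _ F] by blast
  have "{i\<in>I. \<exists>x\<in>Q. \<exists>y\<in>Q. x i \<noteq> y i \<and> card {j\<in>I. x j \<noteq> y j} \<le> w} \<subseteq> U"
  proof safe
    fix i x y assume *: "i \<in> I" "x \<in> Q" "y \<in> Q" "x i \<noteq> y i" "card {j\<in>I. x j \<noteq> y j} \<le> w"
    then have "c x = c y" using c by (auto simp: F_def)
    then have "x i \<noteq> c x i \<or> y i \<noteq> c y i" using * by auto
    then show "i \<in> U" using U * by auto
  qed
  then have "card {i\<in>I. \<exists>x\<in>Q. \<exists>y\<in>Q. x i \<noteq> y i \<and> card {j\<in>I. x j \<noteq> y j} \<le> w} \<le> card U"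
    using UI \<open>finite I\<close> by (meson card_mono finite_subset)
  then show ?thesis using card by linarith
qed

subsection \<open>The cube\<close>

lemma finite_cube [simp]: "finite (cube d)"
  by (simp add: cube_def finite_PiE)

lemma card_cube: "card (cube d) = 2 ^ d"
  by (simp add: cube_def card_PiE numeral_2_eq_2)

lemma cube_nonempty [simp]: "cube d \<noteq> {}"
  using card_cube[of d] by auto

lemma cube_coord: "x \<in> cube d \<Longrightarrow> i \<in> {1..d} \<Longrightarrow> x i = 0 \<or> x i = 1"
  by (auto simp: cube_def PiE_iff)

lemma cube_upd: "x \<in> cube d \<Longrightarrow> i \<in> {1..d} \<Longrightarrow> v \<in> {0, 1} \<Longrightarrow> x(i := v) \<in> cube d"
  by (auto simp: cube_def PiE_iff extensional_def)

definition flip :: "nat \<Rightarrow> point \<Rightarrow> point" where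
  "flip i x = x(i := 1 - x i)"

lemma flip_cube: "x \<in> cube d \<Longrightarrow> i \<in> {1..d} \<Longrightarrow> flip i x \<in> cube d"
  unfolding flip_def by (rule cube_upd) auto

lemma flip_flip: "x \<in> cube d \<Longrightarrow> i \<in> {1..d} \<Longrightarrow> flip i (flip i x) = x"
  using cube_coord[of x d i] by (auto simp: flip_def)

section \<open>Second moment of the imbalance and Chebyshev's inequality\<close>

lemma sum_flip:
  assumes "i \<in> {1..d}"
  shows "(\<Sum>x\<in>cube d. h (flip i x)) = (\<Sum>x\<in>cube d. h x)"
  by (rule sum.reindex_bij_witness[of _ "flip i" "flip i"]) (use assms flip_flip flip_cube in auto)

text \<open>For \<open>j \<noteq> k\<close>, flipping \<open>j\<close> permutes the cube and negates
  exactly one factor, so the sum equals its own negative.\<close>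

lemma sum_sign_products:
  assumes "j \<in> {1..d}" "k \<in> {1..d}"
  shows "(\<Sum>x\<in>cube d. (2 * real (x j) - 1) * (2 * real (x k) - 1)) = (if j = k then 2 ^ d else 0)"
proof (cases "j = k")
  case True
  have "(\<Sum>x\<in>cube d. (2 * real (x j) - 1) * (2 * real (x k) - 1)) = (\<Sum>x\<in>cube d. 1)"
    by (rule sum.cong) (use cube_coord assms True in fastforce)+
  then show ?thesis using True by (simp add: card_cube)
next
  case False
  let ?h = "\<lambda>x. (2 * real (x j) - 1) * (2 * real (x k) - 1)"
  have "?h (flip j x) = - ?h x" if "x \<in> cube d" for x
    using cube_coord[OF that assms(1)] False by (auto simp: flip_def)
  then have "(\<Sum>x\<in>cube d. ?h x) = (\<Sum>x\<in>cube d. - ?h x)"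
    using sum_flip[OF assms(1), of ?h] by simp
  then have "(\<Sum>x\<in>cube d. ?h x) = 0" by (simp add: sum_negf)
  then show ?thesis using False by simp
qed

lemma sum_squared_imbalance:
  assumes "S \<subseteq> {1..d}"
  shows "(\<Sum>x\<in>cube d. (\<Sum>j\<in>S. 2 * real (x j) - 1)\<^sup>2) = real (card S) * 2 ^ d"
proof -
  have fin: "finite S" using assms finite_subset by blast
  have "(\<Sum>x\<in>cube d. (\<Sum>j\<in>S. 2 * real (x j) - 1)\<^sup>2)
      = (\<Sum>x\<in>cube d. \<Sum>j\<in>S. \<Sum>k\<in>S. (2 * real (x j) - 1) * (2 * real (x k) - 1))"
    by (simp add: power2_eq_square sum_product)
  also have "\<dots> = (\<Sum>j\<in>S. \<Sum>x\<in>cube d. \<Sum>k\<in>S. (2 * real (x j) - 1) * (2 * real (x k) - 1))"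
    by (rule sum.swap)
  also have "\<dots> = (\<Sum>j\<in>S. \<Sum>k\<in>S. \<Sum>x\<in>cube d. (2 * real (x j) - 1) * (2 * real (x k) - 1))"
    by (intro sum.cong refl sum.swap)
  also have "\<dots> = (\<Sum>j\<in>S. \<Sum>k\<in>S. if j = k then 2 ^ d else 0)"
    by (intro sum.cong refl sum_sign_products) (use assms in auto)
  also have "\<dots> = real (card S) * 2 ^ d"
    using fin by (simp add: sum.delta)
  finally show ?thesis .
qed

text \<open>Chebyshev's inequality in counting form.\<close>

lemma card_imbalanced:
  assumes "S \<subseteq> {1..d}" "a > 0"
  shows "real (card {x\<in>cube d. \<bar>\<Sum>j\<in>S. 2 * real (x j) - 1\<bar> > a}) * a\<^sup>2 \<le> real (card S) * 2 ^ d"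
proof -
  let ?B = "{x\<in>cube d. \<bar>\<Sum>j\<in>S. 2 * real (x j) - 1\<bar> > a}"
  have "real (card ?B) * a\<^sup>2 = (\<Sum>x\<in>?B. a\<^sup>2)" by simp
  also have "\<dots> \<le> (\<Sum>x\<in>?B. (\<Sum>j\<in>S. 2 * real (x j) - 1)\<^sup>2)"
    by (rule sum_mono) (use assms(2) in \<open>auto simp flip: abs_le_square_iff\<close>)
  also have "\<dots> \<le> (\<Sum>x\<in>cube d. (\<Sum>j\<in>S. 2 * real (x j) - 1)\<^sup>2)"
    by (rule sum_mono2) auto
  finally show ?thesis using sum_squared_imbalance[OF assms(1)] by simp
qed

subsection \<open>The hard functions\<close>

text \<open>Coordinate \<open>i\<close> is left out so that both ends of an edge in direction
  \<open>i\<close> lie on the same step.\<close>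

definition weight_off :: "nat \<Rightarrow> nat \<Rightarrow> point \<Rightarrow> nat" where
  "weight_off d i x = (\<Sum>j\<in>{1..d} - {i}. x j)"

text \<open>With \<open>m = weight_off d i x\<close>, the middle layers are those with
  \<open>\<bar>2 m - (d - 1)\<bar> \<le> 2 s\<close>; they are written so that no subtraction truncates.\<close>
definition hard_fun :: "nat \<Rightarrow> nat \<Rightarrow> nat \<Rightarrow> nat \<Rightarrow> nat \<Rightarrow> point \<Rightarrow> nat" where
  "hard_fun d r s w i x =
     (let u = 2 * weight_off d i x + 2 * s + 1
      in if u < d then 1 else if d + 4 * s < u then r else (u - d) div (2 * w) + 2 - x i)"

lemma weight_off_mono: "cube_le d x y \<Longrightarrow> weight_off d i x \<le> weight_off d i y"
  unfolding weight_off_def cube_le_def by (rule sum_mono) auto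

lemma weight_off_flip: "weight_off d i (flip i x) = weight_off d i x"
  unfolding weight_off_def flip_def by (rule sum.cong) auto

text \<open>The window of length \<open>4 * s\<close> fits into \<open>r - 1\<close> blocks of
  length \<open>2 * w\<close>, so the largest value on a step stays within the range.\<close>

lemma block_index_le:
  fixes r s u w :: nat
  assumes "r \<ge> 2" "2 * s < w * (r - 1)" "u \<le> 4 * s"
  shows "u div (2 * w) + 2 \<le> r"
proof -
  have "u < 2 * w * (r - 1)" using assms by (simp add: mult.assoc)
  then have "u div (2 * w) < r - 1" by (simp add: less_mult_imp_div_less mult.commute)
  then show ?thesis using assms(1) by linarith
qed

lemma hard_fun_in_cube_funs:
  assumes "r \<ge> 2" "2 * s < w * (r - 1)" "i \<in> {1..d}"
  shows "hard_fun d r s w i \<in> cube_funs d r"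
  unfolding cube_funs_def
proof
  fix x assume x: "x \<in> cube d"
  have "(2 * weight_off d i x + 2 * s + 1 - d) div (2 * w) + 2 \<le> r"
    if "2 * weight_off d i x + 2 * s + 1 \<le> d + 4 * s"
    by (rule block_index_le[OF assms(1,2)]) (use that in linarith)
  moreover have "x i \<le> 1" using cube_coord[OF x assms(3)] by auto
  ultimately show "hard_fun d r s w i x \<in> {1..r}"
    using assms(1) by (auto simp: hard_fun_def Let_def)
qed

text \<open>Only the term \<open>- x i\<close> can decrease, and by at most 1, which a rise of the
  block index makes up for. So a violated pair lies in one block and differs at
  \<open>i\<close>.\<close>

lemma hard_fun_violation_close:
  assumes r: "r \<ge> 2" "2 * s < w * (r - 1)" and i: "i \<in> {1..d}"
    and xy: "x \<in> cube d" "y \<in> cube d" "cube_le d x y"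
    and viol: "hard_fun d r s w i x > hard_fun d r s w i y"
  shows "x i \<noteq> y i \<and> card {j\<in>{1..d}. x j \<noteq> y j} \<le> w"
proof -
  let ?m = "weight_off d i"
  let ?u = "\<lambda>x. 2 * ?m x + 2 * s + 1"
  have w: "w > 0" using r by (cases w) auto
  have m: "?m x \<le> ?m y" by (rule weight_off_mono[OF xy(3)])
  have vals: "hard_fun d r s w i z \<in> {1..r}" if "z \<in> cube d" for z
    using hard_fun_in_cube_funs[OF r i] that by (auto simp: cube_funs_def)
  \<comment> \<open>The larger value is not the minimum 1 and the smaller not the maximum
    \<open>r\<close>; as the weight is monotone, both points lie in the middle layers.\<close>
  have "hard_fun d r s w i x \<noteq> 1" "hard_fun d r s w i y \<noteq> r"
    using viol vals[OF xy(1)] vals[OF xy(2)] by auto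
  then have ux: "\<not> ?u x < d" and uy: "\<not> d + 4 * s < ?u y"
    using r by (auto simp: hard_fun_def Let_def split: if_splits)
  have fx: "hard_fun d r s w i x = (?u x - d) div (2 * w) + 2 - x i"
    and fy: "hard_fun d r s w i y = (?u y - d) div (2 * w) + 2 - y i"
    using ux uy m by (auto simp: hard_fun_def Let_def)
  have div_le: "(?u x - d) div (2 * w) \<le> (?u y - d) div (2 * w)"
    by (rule div_le_mono) (use m in linarith)
  have c: "x i = 0 \<or> x i = 1" "y i = 0 \<or> y i = 1" "x i \<le> y i"
    using cube_coord xy i by (auto simp: cube_le_def)
  then have xi: "x i = 0" "y i = 1" and deq: "(?u x - d) div (2 * w) = (?u y - d) div (2 * w)"
    using viol div_le unfolding fx fy by linarith+
  have "?u y - d < (?u x - d) + 2 * w"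
  proof -
    have "?u y - d = 2 * w * ((?u y - d) div (2 * w)) + (?u y - d) mod (2 * w)" by simp
    moreover have "?u x - d \<ge> 2 * w * ((?u x - d) div (2 * w))" by (rule times_div_less_eq_dividend)
    moreover have "(?u y - d) mod (2 * w) < 2 * w" using w by simp
    ultimately show ?thesis unfolding deq by linarith
  qed
  \<comment> \<open>Each unit of weight moves \<open>?u\<close> by 2. The strict inequality leaves
    room for coordinate \<open>i\<close>, which adds 1 to the distance.\<close>
  then have lt: "?m y < ?m x + w" using ux m by linarith
  have le: "x j \<le> y j" if "j \<in> {1..d}" for j using xy(3) that by (auto simp: cube_le_def)
  have "card {j\<in>{1..d}. x j \<noteq> y j} = (\<Sum>j\<in>{1..d}. if x j \<noteq> y j then 1 else 0)"
    by (simp add: sum.If_cases Int_def)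
  also have "\<dots> \<le> (\<Sum>j\<in>{1..d}. y j - x j)"
    by (rule sum_mono) (use le in \<open>fastforce simp: Suc_le_eq\<close>)
  also have "\<dots> = (y i - x i) + (\<Sum>j\<in>{1..d} - {i}. y j - x j)"
    using i by (intro sum.remove) auto
  also have "(\<Sum>j\<in>{1..d} - {i}. y j - x j) = ?m y - ?m x"
    unfolding weight_off_def by (rule sum_subtractf_nat) (use le in auto)
  finally show ?thesis using lt xi m by linarith
qed

text \<open>A monotone \<open>g\<close> must differ from the hard function at an end of every middle
  edge in direction \<open>i\<close>. These edges are disjoint and cover at least 3/4 of the cube,
  so the distance is at least 3/8.\<close>

lemma hard_fun_far:
  assumes r: "r \<ge> 2" "2 * s < w * (r - 1)" and i: "i \<in> {1..d}" and s: "d \<le> s\<^sup>2"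
  shows "far_from_monotone (1/4) d r (hard_fun d r s w i)"
  unfolding far_from_monotone_def
proof (intro ballI impI)
  fix g assume mono: "cube_monotone d g"
  let ?f = "hard_fun d r s w i" and ?m = "weight_off d i"
  define M where "M = {x\<in>cube d. d \<le> 2 * ?m x + 2 * s + 1 \<and> 2 * ?m x + 2 * s + 1 \<le> d + 4 * s}"
  define D where "D = {x\<in>cube d. ?f x \<noteq> g x}"
  have edge: "x \<in> D \<or> flip i x \<in> D" if xM: "x \<in> M" for x
  proof (rule ccontr)
    assume neg: "\<not> (x \<in> D \<or> flip i x \<in> D)"
    have x: "x \<in> cube d" "flip i x \<in> cube d" using xM flip_cube i by (auto simp: M_def)
    then have eq: "g x = ?f x" "g (flip i x) = ?f (flip i x)" using neg by (auto simp: D_def)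
    \<comment> \<open>Both ends share \<open>?b\<close>, and \<open>?b \<ge> 2\<close>, so
      subtracting the coordinate never truncates and the value drops strictly along the
      edge.\<close>
    let ?b = "(2 * ?m x + 2 * s + 1 - d) div (2 * w) + 2"
    have f: "?f x = ?b - x i" "?f (flip i x) = ?b - flip i x i"
      using xM by (auto simp: M_def hard_fun_def Let_def weight_off_flip)
    have gm: "g a \<le> g b" if "a \<in> cube d" "b \<in> cube d" "cube_le d a b" for a b
      using mono that by (auto simp: cube_monotone_def monotone_on_def)
    from cube_coord[OF x(1) i] show False
    proof
      assume xi: "x i = 0"
      then have "g x \<le> g (flip i x)" by (intro gm x) (auto simp: cube_le_def flip_def)
      then have "?b - x i \<le> ?b - flip i x i" using eq f by simp
      then show False using xi by (simp add: flip_def)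
    next
      assume xi: "x i = 1"
      then have "g (flip i x) \<le> g x" by (intro gm x) (auto simp: cube_le_def flip_def)
      then have "?b - flip i x i \<le> ?b - x i" using eq f by simp
      then show False using xi by (simp add: flip_def)
    qed
  qed
  have "M \<subseteq> D \<union> flip i ` D"
  proof
    fix x assume "x \<in> M"
    moreover from this have "x = flip i (flip i x)" using flip_flip[OF _ i, of x] by (simp add: M_def)
    ultimately show "x \<in> D \<union> flip i ` D" using edge by blast
  qed
  moreover have finD: "finite D" by (simp add: D_def)
  ultimately have "card M \<le> card D + card (flip i ` D)"
    by (meson card_Un_le card_mono finite_UnI finite_imageI le_trans)
  then have MD: "card M \<le> 2 * card D" using card_image_le[OF finD, of "flip i"] by linarith

  \<comment> \<open>The threshold \<open>2 * real s\<close> is at least two standard deviations, so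
    Chebyshev leaves at most a quarter of the cube in \<open>?B\<close>.\<close>
  let ?B = "{x\<in>cube d. \<bar>\<Sum>j\<in>{1..d} - {i}. 2 * real (x j) - 1\<bar> > 2 * real s}"
  have imbalance: "(\<Sum>j\<in>{1..d} - {i}. 2 * real (x j) - 1) = 2 * real (?m x) - (real d - 1)" for x
    using i by (simp add: weight_off_def sum_subtractf sum_distrib_left of_nat_diff)
  have "cube d \<subseteq> M \<union> ?B"
  proof
    fix x assume x: "x \<in> cube d"
    show "x \<in> M \<union> ?B"
    proof (cases "x \<in> ?B")
      case False
      then have "\<bar>2 * real (?m x) - (real d - 1)\<bar> \<le> 2 * real s" using x imbalance[of x] by simp
      then have "d \<le> 2 * ?m x + 2 * s + 1 \<and> 2 * ?m x + 2 * s + 1 \<le> d + 4 * s" by linarith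
      then show ?thesis using x by (simp add: M_def)
    qed simp
  qed
  then have "card (cube d) \<le> card (M \<union> ?B)" by (rule card_mono[rotated]) (simp add: M_def)
  then have "card (cube d) \<le> card M + card ?B" using card_Un_le[of M ?B] by linarith
  then have "real (2 ^ d) \<le> real (card M + card ?B)" unfolding card_cube by (rule of_nat_mono)
  then have "2 ^ d \<le> real (card M) + real (card ?B)" by simp
  moreover have "real (card ?B) * (2 * real s)\<^sup>2 \<le> real (card ({1..d} - {i})) * 2 ^ d"
    by (rule card_imbalanced) (use i s in \<open>auto intro!: Nat.gr0I\<close>)
  then have "real (card ?B) * (2 * real s)\<^sup>2 \<le> (real s)\<^sup>2 * 2 ^ d"
  proof (rule order_trans)
    have "card ({1..d} - {i}) \<le> s\<^sup>2" using i s by simp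
    then have "real (card ({1..d} - {i})) \<le> (real s)\<^sup>2" by (simp only: of_nat_le_iff flip: of_nat_power)
    then show "real (card ({1..d} - {i})) * 2 ^ d \<le> (real s)\<^sup>2 * 2 ^ d" by simp
  qed
  then have "(real s)\<^sup>2 * (4 * real (card ?B)) \<le> (real s)\<^sup>2 * 2 ^ d"
    by (simp add: power_mult_distrib algebra_simps)
  then have "4 * real (card ?B) \<le> 2 ^ d"
    using i s by (cases "s = 0") auto
  ultimately have "(2::real) ^ d \<le> 4 * real (card D)"
    using MD by linarith
  then have "1/4 \<le> real (card D) / 2 ^ d" by (simp add: field_simps)
  also have "\<dots> = measure_pmf.prob (pmf_of_set (cube d)) {x. ?f x \<noteq> g x}"
    by (simp add: measure_pmf_of_set card_cube D_def Int_def)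
  finally show "1/4 \<le> measure_pmf.prob (pmf_of_set (cube d)) {x. ?f x \<noteq> g x}" .
qed

subsection \<open>One-sided testers reject only on violated pairs\<close>

lemma monotone_extension:
  assumes f: "f \<in> cube_funs d r" and r: "r \<ge> 1" and Q: "finite Q" "Q \<subseteq> cube d"
    and noviol: "\<forall>x\<in>Q. \<forall>y\<in>Q. cube_le d x y \<longrightarrow> f x \<le> f y"
  shows "\<exists>g\<in>cube_funs d r. cube_monotone d g \<and> (\<forall>x\<in>Q. g x = f x)"
proof -
  \<comment> \<open>The least monotone extension; the inserted 1 is the value where no point of
    \<open>Q\<close> lies below \<open>x\<close>.\<close>
  define g where "g x = Max (insert 1 (f ` {z\<in>Q. cube_le d z x}))" for x
  have fin: "finite (insert 1 (f ` {z\<in>Q. cube_le d z x}))" for x using Q by simp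
  have fr: "f z \<in> {1..r}" if "z \<in> Q" for z using f Q that by (auto simp: cube_funs_def)
  have "g \<in> cube_funs d r"
    using fin r fr by (auto simp: cube_funs_def g_def simp del: Max_insert intro!: Max_ge)
  moreover have "cube_monotone d g"
    unfolding cube_monotone_def monotone_on_def
  proof (intro ballI impI)
    fix x y assume "cube_le d x y"
    then have "cube_le d z y" if "cube_le d z x" for z
      using that unfolding cube_le_def by (meson le_trans)
    then have "insert 1 (f ` {z\<in>Q. cube_le d z x}) \<subseteq> insert 1 (f ` {z\<in>Q. cube_le d z y})"
      by blast
    then show "g x \<le> g y" unfolding g_def by (rule Max_mono) (use fin in auto)
  qed
  moreover have "g x = f x" if "x \<in> Q" for x
    unfolding g_def
  proof (rule Max_eqI[OF fin])
    show "f x \<in> insert 1 (f ` {z\<in>Q. cube_le d z x})" using that by (auto simp: cube_le_def)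
    fix v assume "v \<in> insert 1 (f ` {z\<in>Q. cube_le d z x})"
    then show "v \<le> f x" using noviol fr[OF that] that by auto
  qed
  ultimately show ?thesis by auto
qed

text \<open>Otherwise the answers extend to a monotone \<open>g\<close>. Acceptance probability 1
  forces every algorithm in the support to accept \<open>g\<close>, and on these fixed queries
  \<open>f\<close> gives the same answers.\<close>

lemma one_sided_reject_violation:
  assumes A: "queries_in_cube d A" "one_sided_error d r A"
    and f: "f \<in> cube_funs d r" and r: "r \<ge> 1"
    and mem: "(qs, dec) \<in> set_pmf A" and rej: "\<not> dec (map f qs)"
  shows "\<exists>x\<in>set qs. \<exists>y\<in>set qs. cube_le d x y \<and> f x > f y"
proof (rule ccontr)
  assume "\<not> ?thesis"
  then have nv: "\<forall>x\<in>set qs. \<forall>y\<in>set qs. cube_le d x y \<longrightarrow> f x \<le> f y" by (meson not_le)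
  have "set qs \<subseteq> cube d" using A(1) mem by (auto simp: queries_in_cube_def)
  then obtain g where g: "g \<in> cube_funs d r" "cube_monotone d g" "\<forall>x\<in>set qs. g x = f x"
    using monotone_extension[OF f r _ _ nv] by auto
  then have "accept_prob A g = 1" using A(2) by (auto simp: one_sided_error_def)
  then have "AE p in measure_pmf A. p \<in> {(qs, dec). dec (map g qs)}"
    unfolding accept_prob_def by (subst (asm) measure_pmf.prob_eq_1) auto
  then have "dec (map g qs)" using mem by (auto simp: AE_measure_pmf_iff)
  moreover have "map g qs = map f qs" using g(3) by simp
  ultimately show False using rej by simp
qed

text \<open>Double counting of the expected number of directions whose hard function is rejected: at
  least 2/3 for each direction, but never more than \<open>w * q\<close> for any outcome of the coin
  tosses.\<close>

lemma query_bound: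
  assumes r: "r \<ge> 2" "2 * s < w * (r - 1)" and s: "d \<le> s\<^sup>2"
    and A: "nonadaptive_monotonicity_tester (1/4) d r A" "one_sided_error d r A"
      "makes_at_most_queries A q"
  shows "2/3 * real d \<le> real (w * q)"
proof -
  define R where "R i = {(qs, dec). \<not> dec (map (hard_fun d r s w i) qs)}" for i
  have int: "integrable A (indicat_real (R i))" for i
    by (rule measure_pmf.integrable_const_bound[where B=1]) auto
  have inc: "queries_in_cube d A" using A(1) by (simp add: nonadaptive_monotonicity_tester_def)
  have "2/3 * real d = (\<Sum>i\<in>{1..d}. 2/3)" by simp
  also have "\<dots> \<le> (\<Sum>i\<in>{1..d}. measure_pmf.prob A (R i))"
  proof (rule sum_mono)
    fix i assume i: "i \<in> {1..d}"
    have "reject_prob A (hard_fun d r s w i) \<ge> 2/3"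
      using A(1) hard_fun_in_cube_funs[OF r i] hard_fun_far[OF r i s]
      by (auto simp: nonadaptive_monotonicity_tester_def)
    then show "2/3 \<le> measure_pmf.prob A (R i)" by (simp add: reject_prob_def R_def)
  qed
  also have "\<dots> = measure_pmf.expectation A (\<lambda>p. \<Sum>i\<in>{1..d}. indicat_real (R i) p)"
    using int by simp
  also have "\<dots> \<le> real (w * q)"
  proof (rule measure_pmf.integral_le_const)
    show "integrable A (\<lambda>p. \<Sum>i\<in>{1..d}. indicat_real (R i) p)"
      using int by (intro Bochner_Integration.integrable_sum)
    show "AE p in A. (\<Sum>i\<in>{1..d}. indicat_real (R i) p) \<le> real (w * q)"
      unfolding AE_measure_pmf_iff
    proof
      fix p assume p: "p \<in> set_pmf A"
      obtain qs dec where pe: "p = (qs, dec)" by (cases p)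
      have qs: "set qs \<subseteq> cube d" "length qs \<le> q"
        using inc A(3) p pe by (auto simp: queries_in_cube_def makes_at_most_queries_def)
      let ?S = "{i\<in>{1..d}. \<exists>x\<in>set qs. \<exists>y\<in>set qs. x i \<noteq> y i \<and> card {j\<in>{1..d}. x j \<noteq> y j} \<le> w}"
      have "i \<in> ?S" if i: "i \<in> {1..d}" "p \<in> R i" for i
      proof -
        have "\<not> dec (map (hard_fun d r s w i) qs)" using i pe by (simp add: R_def)
        then obtain x y where xy: "x \<in> set qs" "y \<in> set qs" "cube_le d x y"
            "hard_fun d r s w i x > hard_fun d r s w i y"
          using one_sided_reject_violation[OF inc A(2) hard_fun_in_cube_funs[OF r i(1)]] r p pe
          by fastforce
        then show ?thesis
          using hard_fun_violation_close[OF r i(1) _ _ xy(3,4)] qs(1) i(1) by blast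
      qed
      then have "{i\<in>{1..d}. p \<in> R i} \<subseteq> ?S" by blast
      then have "card {i\<in>{1..d}. p \<in> R i} \<le> card ?S" by (intro card_mono) auto
      also have "\<dots> \<le> w * card (set qs)" by (rule card_directions_of_close_pairs) auto
      also have "\<dots> \<le> w * q" using qs(2) card_length[of qs] by (intro mult_le_mono2) linarith
      finally show "(\<Sum>i\<in>{1..d}. indicat_real (R i) p) \<le> real (w * q)"
        by (simp add: indicator_def sum.If_cases Int_def flip: of_nat_mult)
    qed
  qed
  finally show ?thesis .
qed

section \<open>Choice of the step width and the constants\<close>

theorem theorem1p7:
  "\<exists>\<epsilon>>0. \<exists>c>0. \<forall>(d::nat) (r::nat). r \<ge> 2 \<longrightarrow>
     (\<forall>A q. nonadaptive_monotonicity_tester \<epsilon> d r A \<and> one_sided_error d r A \<and>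
            makes_at_most_queries A q \<longrightarrow>
        real q \<ge> c * min (real r * sqrt (real d)) (real d))"
proof (rule exI[of _ "1/4"], rule conjI, simp, rule exI[of _ "2/27"], rule conjI, simp,
    intro allI impI, elim conjE)
  fix d r q :: nat and A
  assume r: "r \<ge> 2" and A: "nonadaptive_monotonicity_tester (1/4) d r A" "one_sided_error d r A"
    "makes_at_most_queries A q"
  show "real q \<ge> 2/27 * min (real r * sqrt (real d)) (real d)"
  proof (cases "d = 0")
    case False
    then have d1: "sqrt (real d) \<ge> 1" by simp
    \<comment> \<open>\<open>s\<close> is rounded up to give \<open>d \<le> s\<^sup>2\<close>, and
      \<open>w\<close> is the least width with \<open>2 * s < w * (r - 1)\<close>.\<close>
    define s where "s = nat \<lceil>sqrt (real d)\<rceil>"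
    define w where "w = 2 * s div (r - 1) + 1"
    define mn where "mn = min (real r * sqrt (real d)) (real d)"
    have s1: "sqrt (real d) \<le> real s" unfolding s_def by (rule real_nat_ceiling_ge)
    then have "(sqrt (real d))\<^sup>2 \<le> (real s)\<^sup>2" by (intro power_mono) auto
    then have s: "d \<le> s\<^sup>2" by (simp flip: of_nat_power)
    have "real s \<le> sqrt (real d) + 1" unfolding s_def using d1 by linarith
    then have s2: "real s \<le> 2 * sqrt (real d)" using d1 by linarith
    have w: "2 * s < w * (r - 1)"
      unfolding w_def using r dividend_less_div_times[of "r - 1" "2 * s"] by (simp add: add.commute)
    have "(w - 1) * (r - 1) \<le> 2 * s" by (simp add: w_def)
    then have "real (w - 1) * real (r - 1) \<le> 2 * real s"
      by (metis of_nat_le_iff of_nat_mult of_nat_numeral)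
    \<comment> \<open>Since \<open>r \<ge> 2\<close>, replacing \<open>r - 1\<close> by
      \<open>r\<close> costs a factor 2; with \<open>2 * s\<close> at most 4 times the root of
      \<open>d\<close> this gives 8.\<close>
    moreover have "real (w - 1) * real r \<le> real (w - 1) * (2 * real (r - 1))"
      using r by (intro mult_left_mono) auto
    ultimately have wr: "real (w - 1) * real r \<le> 8 * sqrt (real d)" using s2 by linarith
    have mn0: "mn \<ge> 0" by (simp add: mn_def)
    \<comment> \<open>The first bound in the minimum is used against \<open>w - 1\<close>, the
      second against the remaining 1. The total \<open>9 * d\<close> turns the 2/3 of
      \<open>query_bound\<close> into 2/27.\<close>
    have "mn * real w = mn * real (w - 1) + mn" by (simp add: w_def algebra_simps)
    also have "\<dots> \<le> real r * sqrt (real d) * real (w - 1) + real d"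
      by (intro add_mono mult_right_mono) (auto simp: mn_def)
    also have "\<dots> = (real (w - 1) * real r) * sqrt (real d) + real d" by (simp add: mult_ac)
    also have "\<dots> \<le> 8 * sqrt (real d) * sqrt (real d) + real d"
      by (intro add_mono mult_right_mono wr) auto
    also have "\<dots> = 9 * real d" by simp
    finally have "2/27 * mn * real w \<le> 2/3 * real d" by simp
    also have "\<dots> \<le> real q * real w" using query_bound[OF r w s A] by (simp add: mult.commute)
    finally show ?thesis unfolding mn_def[symmetric] by (simp add: w_def)
  qed simp
qed

end
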